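(* Let $(X,d)$ be an $m$-space with $X$ finite, let $K$ be a finite set with at least two elements, and let $P=(P_k)_{k\in K}$ be a tuple of nonempty subsets of $X$. Then there are nonnegative integers $n_1,N_1\le\sum_{k\in K}(|X|-|P_k|)$ such that $$R=\mathrm{Dom}^{2n_1}P,\qquad S=\mathrm{Dom}^{2N_1}\big((X)_{k\in K}\big)$$ are double zone diagrams in $X$ with respect to $P$.
   Context: An $m$-space is a pair $(X,d)$ of a nonempty set $X$ and a function $d:X^2\to[-\infty,\infty]$ such that $d(x,x)\le d(x,y)$ for all $x,y\in X$ (no symmetry, positivity or triangle inequality is assumed). For $x\in X$ and a nonempty $A\subseteq X$, $d(x,A)=\inf\{d(x,y):y\in A\}$. For nonempty $P,A\subseteq X$, $\mathrm{dom}(P,A)=\{x\in X: d(x,P)\le d(x,A)\}$; it contains $P$, hence is nonempty. Given a tuple $(P_k)_{k\in K}$ of nonempty subsets of $X$, the mapping $\mathrm{Dom}$ from the set of all tuples $(R_k)_{k\in K}$ of nonempty subsets of $X$ to itself is defined by $\mathrm{Dom}(R)=\big(\mathrm{dom}(P_k,\bigcup_{j\ne k}R_j)\big)_{k\in K}$. A double zone diagram with respect to $P$ is a fixed point of $\mathrm{Dom}^2=\mathrm{Dom}\circ\mathrm{Dom}$. $\mathrm{Dom}^{n}$ denotes the $n$-th iterate ($\mathrm{Dom}^0$ is the identity), $(X)_{k\in K}$ is the tuple all of whose components equal $X$, and $|\cdot|$ denotes cardinality. *)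

theory Defs
  imports "HOL-Library.Extended_Real" "HOL-Library.FuncSet"
begin

definition m_space :: "'a set \<Rightarrow> ('a \<Rightarrow> 'a \<Rightarrow> ereal) \<Rightarrow> bool" where
  "m_space X d \<longleftrightarrow> X \<noteq> {} \<and> (\<forall>x\<in>X. \<forall>y\<in>X. d x x \<le> d x y)"

definition set_dist :: "('a \<Rightarrow> 'a \<Rightarrow> ereal) \<Rightarrow> 'a \<Rightarrow> 'a set \<Rightarrow> ereal" where
  "set_dist d x A = (INF y\<in>A. d x y)"

definition dominance :: "'a set \<Rightarrow> ('a \<Rightarrow> 'a \<Rightarrow> ereal) \<Rightarrow> 'a set \<Rightarrow> 'a set \<Rightarrow> 'a set" where
  "dominance X d P A = {x \<in> X. set_dist d x P \<le> set_dist d x A}"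

text \<open>Tuples indexed by \<open>K\<close> are extensional functions (undefined outside \<open>K\<close>),
  so that equality of functions is equality of tuples.\<close>

definition tuples :: "'a set \<Rightarrow> 'k set \<Rightarrow> ('k \<Rightarrow> 'a set) set" where
  "tuples X K = (K \<rightarrow>\<^sub>E {A. A \<subseteq> X \<and> A \<noteq> {}})"

definition Dom ::
  "'a set \<Rightarrow> ('a \<Rightarrow> 'a \<Rightarrow> ereal) \<Rightarrow> 'k set \<Rightarrow> ('k \<Rightarrow> 'a set) \<Rightarrow> ('k \<Rightarrow> 'a set) \<Rightarrow> ('k \<Rightarrow> 'a set)" where
  "Dom X d K P R = (\<lambda>k\<in>K. dominance X d (P k) (\<Union>j\<in>K - {k}. R j))"

definition double_zone_diagram ::
  "'a set \<Rightarrow> ('a \<Rightarrow> 'a \<Rightarrow> ereal) \<Rightarrow> 'k set \<Rightarrow> ('k \<Rightarrow> 'a set) \<Rightarrow> ('k \<Rightarrow> 'a set) \<Rightarrow> bool" where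
  "double_zone_diagram X d K P R \<longleftrightarrow> R \<in> tuples X K \<and> (Dom X d K P ^^ 2) R = R"

lemma dominance_superset:
  assumes "m_space X d" "P \<subseteq> X" "A \<subseteq> X"
  shows "P \<subseteq> dominance X d P A"
proof
  fix x assume x: "x \<in> P"
  have "set_dist d x P \<le> d x x"
    using x by (auto simp: set_dist_def intro: INF_lower)
  also have "d x x \<le> set_dist d x A"
    using assms x by (auto simp: set_dist_def m_space_def intro!: INF_greatest)
  finally show "x \<in> dominance X d P A"
    using assms x by (auto simp: dominance_def)
qed

lemma Dom_in_tuples:
  assumes "m_space X d" "P \<in> tuples X K" "R \<in> tuples X K"
  shows "Dom X d K P R \<in> tuples X K"
proof -
  have "dominance X d (P k) (\<Union>j\<in>K - {k}. R j) \<subseteq> X \<and>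
        dominance X d (P k) (\<Union>j\<in>K - {k}. R j) \<noteq> {}" if k: "k \<in> K" for k
  proof -
    have P: "P k \<subseteq> X" "P k \<noteq> {}" using assms(2) k by (auto simp: tuples_def PiE_def Pi_def)
    have R: "(\<Union>j\<in>K - {k}. R j) \<subseteq> X" using assms(3) by (auto simp: tuples_def PiE_def Pi_def)
    have "P k \<subseteq> dominance X d (P k) (\<Union>j\<in>K - {k}. R j)"
      by (rule dominance_superset[OF assms(1) P(1) R])
    then show ?thesis using P by (auto simp: dominance_def)
  qed
  then show ?thesis by (simp add: Dom_def tuples_def)
qed

end

theory Submission
  imports Defs
begin

text \<open>Enlarging the tuple \<open>R\<close> shrinks every distance to \<open>\<Union>j\<in>K - {k}. R j\<close>, so \<open>Dom\<close> reverses the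
  componentwise order (\<open>Dom_antimono\<close>) and \<open>Dom\<^sup>2\<close> is monotone. Every value of \<open>Dom\<close> lies
  componentwise between \<open>P\<close> and the constant tuple \<open>X\<close>; in particular \<open>P \<le> Dom\<^sup>2 P\<close> and
  \<open>Dom\<^sup>2 X \<le> X\<close>, so by monotonicity the \<open>Dom\<^sup>2\<close>-iterates of \<open>P\<close> increase and those of the constant
  tuple \<open>X\<close> decrease. A strict step changes the total cardinality of the components by at least
  one, and the total cardinalities of \<open>X\<close> and \<open>P\<close> differ by \<open>\<Sum>k\<in>K. card X - card (P k)\<close>. Hence at
  most that many strict steps occur before two consecutive iterates agree
  (\<open>stationary_of_bounded_potential\<close>), and an iterate equal to its successor is a fixed point
  of \<open>Dom\<^sup>2\<close>.

  Tuples are compared by the pointwise order on functions. This is the componentwise order over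
  \<open>K\<close>, because any two tuples take the same (undefined) value outside \<open>K\<close>.\<close>

lemma set_dist_antimono: "A \<subseteq> B \<Longrightarrow> set_dist d x B \<le> set_dist d x A"
  unfolding set_dist_def by (rule INF_superset_mono) auto

lemma dominance_antimono: "A \<subseteq> B \<Longrightarrow> dominance X d P B \<subseteq> dominance X d P A"
  unfolding dominance_def using set_dist_antimono[of A B d] by (blast intro: order_trans)

lemma Dom_antimono:
  assumes "R \<le> S"
  shows "Dom X d K P S \<le> Dom X d K P R"
proof (rule le_funI)
  fix k
  have "(\<Union>j\<in>K - {k}. R j) \<subseteq> (\<Union>j\<in>K - {k}. S j)"
    using assms by (auto simp: le_fun_def)
  then show "Dom X d K P S k \<le> Dom X d K P R k"
    by (simp add: Dom_def dominance_antimono)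
qed

lemma mono_Dom_Dom: "mono (Dom X d K P ^^ 2)"
  by (auto simp: mono_def numeral_2_eq_2 intro: Dom_antimono)

lemma tuples_le_const:
  assumes "R \<in> tuples X K"
  shows "R \<le> (\<lambda>k\<in>K. X)"
proof (rule le_funI)
  fix k show "R k \<le> (\<lambda>k\<in>K. X) k"
    using assms by (cases "k \<in> K") (auto simp: tuples_def PiE_def Pi_def extensional_def)
qed

lemma le_Dom:
  assumes "m_space X d" "P \<in> tuples X K" "R \<in> tuples X K"
  shows "P \<le> Dom X d K P R"
proof (rule le_funI)
  fix k show "P k \<le> Dom X d K P R k"
  proof (cases "k \<in> K")
    case True
    have "P k \<subseteq> X" "(\<Union>j\<in>K - {k}. R j) \<subseteq> X"
      using assms True by (auto simp: tuples_def PiE_def Pi_def)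
    then show ?thesis
      using dominance_superset[OF assms(1)] True by (simp add: Dom_def)
  next
    case False
    then show ?thesis
      using assms(2) by (auto simp: Dom_def tuples_def PiE_def extensional_def)
  qed
qed

lemma funpow_Dom_in_tuples:
  assumes "m_space X d" "P \<in> tuples X K" "R \<in> tuples X K"
  shows "(Dom X d K P ^^ n) R \<in> tuples X K"
  by (induction n) (simp_all add: assms Dom_in_tuples)

lemma le_funpow_Dom_Dom:
  assumes "m_space X d" "P \<in> tuples X K" "R \<in> tuples X K" "P \<le> R"
  shows "P \<le> ((Dom X d K P ^^ 2) ^^ n) R"
proof (cases n)
  case 0
  then show ?thesis using assms(4) by simp
next
  case (Suc m)
  \<comment> \<open>The iterate is a value of \<open>Dom\<close>, so it contains \<open>P\<close>.\<close>
  have "P \<le> Dom X d K P ((Dom X d K P ^^ Suc (2 * m)) R)"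
    using assms by (intro le_Dom funpow_Dom_in_tuples)
  then show ?thesis by (simp add: Suc funpow_mult del: funpow.simps) simp
qed

lemma stationary_of_bounded_potential:
  fixes a :: "nat \<Rightarrow> 'b" and g :: "nat \<Rightarrow> nat"
  assumes step: "\<And>n. a (Suc n) \<noteq> a n \<Longrightarrow> g n < g (Suc n)"
    and bound: "\<And>n. g n \<le> M"
  shows "\<exists>n\<le>M. a (Suc n) = a n"
proof (rule ccontr)
  assume "\<not> ?thesis"
  then have ne: "n \<le> M \<Longrightarrow> a (Suc n) \<noteq> a n" for n by blast
  have "n \<le> Suc M \<Longrightarrow> n \<le> g n" for n
  proof (induction n)
    case (Suc n)
    then show ?case using step[OF ne, of n] by simp
  qed simp
  from this[of "Suc M"] bound[of "Suc M"] show False by simp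
qed

text \<open>Neither potential is truncated by subtraction on the naturals, because all tuples compared
  lie between \<open>P\<close> and the constant tuple \<open>X\<close>.\<close>

lemma potential_strict_mono:
  assumes "finite X" "finite K" "R \<in> tuples X K" "S \<in> tuples X K"
    and "P \<le> R" "R \<le> S" "R \<noteq> S"
  shows "(\<Sum>k\<in>K. card (R k) - card (P k)) < (\<Sum>k\<in>K. card (S k) - card (P k))"
    and "(\<Sum>k\<in>K. card X - card (S k)) < (\<Sum>k\<in>K. card X - card (R k))"
proof -
  have sub: "P k \<subseteq> R k" "R k \<subseteq> S k" for k
    using assms by (auto simp: le_fun_def)
  have SX: "S k \<subseteq> X" if "k \<in> K" for k
    using assms(4) that by (auto simp: tuples_def PiE_def Pi_def)
  have fin: "finite (S k)" if "k \<in> K" for k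
    using SX[OF that] assms(1) finite_subset by blast
  have le: "card (P k) \<le> card (R k)" "card (R k) \<le> card (S k)" "card (S k) \<le> card X"
    if "k \<in> K" for k
    using sub SX fin that assms(1) by (meson card_mono finite_subset)+
  have "\<exists>k\<in>K. R k \<noteq> S k"
    using assms(3,4,7) PiE_ext[of R K _ S] unfolding tuples_def by blast
  then obtain k where k: "k \<in> K" "R k \<noteq> S k" by blast
  have lt: "card (R k) < card (S k)"
    using sub(2)[of k] k(2) by (intro psubset_card_mono fin k(1)) blast
  show "(\<Sum>k\<in>K. card (R k) - card (P k)) < (\<Sum>k\<in>K. card (S k) - card (P k))"
  proof (rule sum_strict_mono_ex1[OF assms(2)])
    show "\<forall>k\<in>K. card (R k) - card (P k) \<le> card (S k) - card (P k)"
      using le(2) by (blast intro: diff_le_mono)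
    show "\<exists>k\<in>K. card (R k) - card (P k) < card (S k) - card (P k)"
      using diff_less_mono[OF lt le(1)[OF k(1)]] k(1) by blast
  qed
  show "(\<Sum>k\<in>K. card X - card (S k)) < (\<Sum>k\<in>K. card X - card (R k))"
  proof (rule sum_strict_mono_ex1[OF assms(2)])
    show "\<forall>k\<in>K. card X - card (S k) \<le> card X - card (R k)"
      using le(2) by (blast intro: diff_le_mono2)
    show "\<exists>k\<in>K. card X - card (S k) < card X - card (R k)"
      using diff_less_mono2[OF lt order_less_le_trans[OF lt le(3)[OF k(1)]]] k(1) by blast
  qed
qed

theorem theorem7p2:
  fixes X :: "'a set" and d :: "'a \<Rightarrow> 'a \<Rightarrow> ereal"
    and K :: "'k set" and P :: "'k \<Rightarrow> 'a set"
  assumes "m_space X d" and "finite X"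
    and "finite K" and "card K \<ge> 2"
    and "P \<in> tuples X K"
  shows "\<exists>n\<^sub>1 N\<^sub>1 :: nat.
    n\<^sub>1 \<le> (\<Sum>k\<in>K. card X - card (P k)) \<and>
    N\<^sub>1 \<le> (\<Sum>k\<in>K. card X - card (P k)) \<and>
    double_zone_diagram X d K P ((Dom X d K P ^^ (2 * n\<^sub>1)) P) \<and>
    double_zone_diagram X d K P ((Dom X d K P ^^ (2 * N\<^sub>1)) (\<lambda>k\<in>K. X))"
proof -
  define M where "M = (\<Sum>k\<in>K. card X - card (P k))"
  define F where "F = Dom X d K P ^^ 2"
  define T :: "'k \<Rightarrow> 'a set" where "T = (\<lambda>k\<in>K. X)"
  have T: "T \<in> tuples X K"
    using assms(1) by (auto simp: T_def tuples_def m_space_def)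
  have PT: "P \<le> T"
    unfolding T_def by (rule tuples_le_const[OF assms(5)])
  have iter: "F ^^ n = Dom X d K P ^^ (2 * n)" for n
    by (simp add: F_def funpow_mult mult.commute)
  have tup: "(F ^^ n) R \<in> tuples X K" if "R \<in> tuples X K" for n R
    unfolding iter by (rule funpow_Dom_in_tuples[OF assms(1,5) that])
  have lower: "P \<le> (F ^^ n) R" if "R \<in> tuples X K" "P \<le> R" for n R
    unfolding F_def by (rule le_funpow_Dom_Dom[OF assms(1,5) that])
  have mono: "mono F"
    unfolding F_def by (rule mono_Dom_Dom)
  have fixed: "double_zone_diagram X d K P ((Dom X d K P ^^ (2 * n)) R)"
    if "R \<in> tuples X K" "(F ^^ Suc n) R = (F ^^ n) R" for n R
    using that tup[OF that(1), of n]
    by (simp add: double_zone_diagram_def iter[symmetric] F_def[symmetric])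
  have card_le: "card (R k) \<le> card X" if "R \<in> tuples X K" "k \<in> K" for R k
    using that assms(2) by (auto simp: tuples_def PiE_def Pi_def intro!: card_mono)
  have up: "(F ^^ n) P \<le> (F ^^ Suc n) P" for n
    using funpow_mono[OF mono lower[OF assms(5) order_refl, of 1], of n]
    by (simp add: funpow_swap1)
  have down: "(F ^^ Suc n) T \<le> (F ^^ n) T" for n
    using funpow_mono[OF mono tuples_le_const[OF tup[OF T, of 1]], of n]
    by (simp add: funpow_swap1 T_def)
  have "\<exists>n\<le>M. (F ^^ Suc n) P = (F ^^ n) P"
  proof (rule stationary_of_bounded_potential
      [where g = "\<lambda>n. \<Sum>k\<in>K. card ((F ^^ n) P k) - card (P k)"])
    fix n assume "(F ^^ Suc n) P \<noteq> (F ^^ n) P"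
    then show "(\<Sum>k\<in>K. card ((F ^^ n) P k) - card (P k))
        < (\<Sum>k\<in>K. card ((F ^^ Suc n) P k) - card (P k))"
      by (intro potential_strict_mono(1)[OF assms(2,3)] tup lower up assms(5)) auto
  next
    fix n show "(\<Sum>k\<in>K. card ((F ^^ n) P k) - card (P k)) \<le> M"
      unfolding M_def by (intro sum_mono diff_le_mono card_le tup assms(5))
  qed
  then obtain n where n: "n \<le> M" "(F ^^ Suc n) P = (F ^^ n) P" by blast
  have "\<exists>n\<le>M. (F ^^ Suc n) T = (F ^^ n) T"
  proof (rule stationary_of_bounded_potential
      [where g = "\<lambda>n. \<Sum>k\<in>K. card X - card ((F ^^ n) T k)"])
    fix n assume "(F ^^ Suc n) T \<noteq> (F ^^ n) T"
    then show "(\<Sum>k\<in>K. card X - card ((F ^^ n) T k))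
        < (\<Sum>k\<in>K. card X - card ((F ^^ Suc n) T k))"
      by (intro potential_strict_mono(2)[OF assms(2,3) _ _ lower[OF T PT]] tup down T) auto
  next
    fix n
    have "card (P k) \<le> card ((F ^^ n) T k)" if "k \<in> K" for k
    proof (rule card_mono)
      show "finite ((F ^^ n) T k)"
        using tup[OF T, of n] that assms(2)
        by (auto simp: tuples_def PiE_def Pi_def intro: finite_subset)
      show "P k \<subseteq> (F ^^ n) T k"
        using lower[OF T PT, of n] by (simp add: le_fun_def)
    qed
    then show "(\<Sum>k\<in>K. card X - card ((F ^^ n) T k)) \<le> M"
      unfolding M_def by (intro sum_mono diff_le_mono2)
  qed
  then obtain N where N: "N \<le> M" "(F ^^ Suc N) T = (F ^^ N) T" by blast
  show ?thesis
    using n(1) N(1) fixed[OF assms(5) n(2)] fixed[OF T N(2)]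
    unfolding M_def T_def by blast
qed

end
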